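(* Let $\mathcal{C}_1$ and $\mathcal{C}_2$ be two coarse structures on the same set $X$. Suppose that (1) a subset of $X$ is bounded in $\mathcal{C}_1$ if and only if it is bounded in $\mathcal{C}_2$; (2) there are a coarse action $\phi_1$ of a group $G_1$ on $(X,\mathcal{C}_1)$ and a coarse action $\phi_2$ of a group $G_2$ on $(X,\mathcal{C}_2)$ such that $\phi_1$ commutes with $\phi_2$. Then $\mathcal{C}_1$ and $\mathcal{C}_2$ are equivalent, i.e. there is a coarse equivalence from $(X,\mathcal{C}_1)$ to $(X,\mathcal{C}_2)$.
   Context: Coarse structures. A coarse structure $\mathcal{C}$ on a set $X$ is a nonempty collection of families of subsets of $X$ (its members are called uniformly bounded families) such that: (1) if $\mathcal{B}_1\in\mathcal{C}$ and $\mathcal{B}_2$ is a family of subsets of $X$ each of whose elements consisting of more than one point is contained in some element of $\mathcal{B}_1$, then $\mathcal{B}_2\in\mathcal{C}$; (2) if $\mathcal{B}_1,\mathcal{B}_2\in\mathcal{C}$ then $\mathrm{St}(\mathcal{B}_1,\mathcal{B}_2)\in\mathcal{C}$, where $\mathrm{St}(B,\mathcal{B}_2)=B\cup\bigcup\{A\in\mathcal{B}_2: A\cap B\neq\emptyset\}$ and $\mathrm{St}(\mathcal{B}_1,\mathcal{B}_2)=\{\mathrm{St}(B,\mathcal{B}_2): B\in\mathcal{B}_1\}$. A set $B\subset X$ is bounded if $\{B\}\in\mathcal{C}$. A set $E\subset X\times X$ is controlled if $E\subset\bigcup_{B\in\mathcal{B}}B\times B$ for some $\mathcal{B}\in\mathcal{C}$.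 Maps. A function $f:(X,\mathcal{C}_X)\to(Y,\mathcal{C}_Y)$ is large scale uniform (bornologous) if $f(\mathcal{B})=\{f(B):B\in\mathcal{B}\}\in\mathcal{C}_Y$ for every $\mathcal{B}\in\mathcal{C}_X$; it is coarsely proper if $f^{-1}(U)$ is bounded for every bounded $U\subset Y$; it is coarse if it is both. Two functions $f,g:S\to(X,\mathcal{C}_X)$ are close if the family $\{\{f(s),g(s)\}\}_{s\in S}$ is uniformly bounded. A coarse function $f:X\to Y$ is a coarse equivalence if there is a coarse function $g:Y\to X$ with $f\circ g$ close to $\mathrm{id}_Y$ and $g\circ f$ close to $\mathrm{id}_X$. Actions. An action of a group $G$ on $(X,\mathcal{C})$ is: by uniformly bornologous functions if for every controlled set $E$ there is a controlled set $E'$ with $(g\cdot x,g\cdot y)\in E'$ for all $(x,y)\in E$ and $g\in G$; coarsely proper if for each $x\in X$ and each bounded $U\subset X$ the set $\{g\in G: g\cdot x\in U\}$ is finite; cobounded if $X=G\cdot U$ for some bounded $U\subset X$; coarse if it is coarsely proper, cobounded, and by uniformly bornologous functions. Two left actions of $G_1$ and $G_2$ on $X$ commute if $g_1\cdot(g_2\cdot x)=g_2\cdot(g_1\cdot x)$ for all $g_1\in G_1$, $g_2\in G_2$, $x\in X$. *)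

theory Defs
  imports "HOL-Algebra.Group_Action"
begin

text \<open>
  Coarse structures are given by their uniformly bounded families, on a carrier set \<open>X\<close>.
  They are not assumed to be connected: the union of two bounded sets need not be bounded.
  Maps \<open>X \<rightarrow> Y\<close> are HOL functions whose values outside \<open>X\<close> are irrelevant.
\<close>

definition star_set :: "'a set \<Rightarrow> 'a set set \<Rightarrow> 'a set" where
  "star_set B \<B> = B \<union> \<Union>{A \<in> \<B>. A \<inter> B \<noteq> {}}"

definition star_family :: "'a set set \<Rightarrow> 'a set set \<Rightarrow> 'a set set" where
  "star_family \<B>1 \<B>2 = {star_set B \<B>2 | B. B \<in> \<B>1}"

definition coarse_structure :: "'a set \<Rightarrow> 'a set set set \<Rightarrow> bool" where
  "coarse_structure X \<C> \<longleftrightarrow>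
     \<C> \<noteq> {} \<and> \<C> \<subseteq> Pow (Pow X) \<and>
     (\<forall>\<B>1 \<in> \<C>. \<forall>\<B>2. \<B>2 \<subseteq> Pow X \<longrightarrow>
        (\<forall>B \<in> \<B>2. (\<exists>x \<in> B. \<exists>y \<in> B. x \<noteq> y) \<longrightarrow> (\<exists>A \<in> \<B>1. B \<subseteq> A)) \<longrightarrow> \<B>2 \<in> \<C>) \<and>
     (\<forall>\<B>1 \<in> \<C>. \<forall>\<B>2 \<in> \<C>. star_family \<B>1 \<B>2 \<in> \<C>)"

definition coarse_bounded :: "'a set set set \<Rightarrow> 'a set \<Rightarrow> bool" where
  "coarse_bounded \<C> B \<longleftrightarrow> {B} \<in> \<C>"

definition controlled :: "'a set set set \<Rightarrow> ('a \<times> 'a) set \<Rightarrow> bool" where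
  "controlled \<C> E \<longleftrightarrow> (\<exists>\<B> \<in> \<C>. E \<subseteq> (\<Union>B \<in> \<B>. B \<times> B))"

definition large_scale_uniform ::
    "'a set set set \<Rightarrow> 'b set set set \<Rightarrow> ('a \<Rightarrow> 'b) \<Rightarrow> bool" where
  "large_scale_uniform \<C>X \<C>Y f \<longleftrightarrow> (\<forall>\<B> \<in> \<C>X. {f ` B | B. B \<in> \<B>} \<in> \<C>Y)"

definition coarsely_proper_map ::
    "'a set \<Rightarrow> 'a set set set \<Rightarrow> 'b set \<Rightarrow> 'b set set set \<Rightarrow> ('a \<Rightarrow> 'b) \<Rightarrow> bool" where
  "coarsely_proper_map X \<C>X Y \<C>Y f \<longleftrightarrow>
     (\<forall>U \<subseteq> Y. coarse_bounded \<C>Y U \<longrightarrow> coarse_bounded \<C>X (f -` U \<inter> X))"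

definition coarse_map ::
    "'a set \<Rightarrow> 'a set set set \<Rightarrow> 'b set \<Rightarrow> 'b set set set \<Rightarrow> ('a \<Rightarrow> 'b) \<Rightarrow> bool" where
  "coarse_map X \<C>X Y \<C>Y f \<longleftrightarrow>
     f \<in> X \<rightarrow> Y \<and> large_scale_uniform \<C>X \<C>Y f \<and> coarsely_proper_map X \<C>X Y \<C>Y f"

definition close_maps ::
    "'s set \<Rightarrow> 'a set set set \<Rightarrow> ('s \<Rightarrow> 'a) \<Rightarrow> ('s \<Rightarrow> 'a) \<Rightarrow> bool" where
  "close_maps S \<C> f g \<longleftrightarrow> {{f s, g s} | s. s \<in> S} \<in> \<C>"

definition coarse_equivalence ::
    "'a set \<Rightarrow> 'a set set set \<Rightarrow> 'b set \<Rightarrow> 'b set set set \<Rightarrow> ('a \<Rightarrow> 'b) \<Rightarrow> bool" where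
  "coarse_equivalence X \<C>X Y \<C>Y f \<longleftrightarrow>
     coarse_map X \<C>X Y \<C>Y f \<and>
     (\<exists>g. coarse_map Y \<C>Y X \<C>X g \<and> close_maps Y \<C>Y (f \<circ> g) id \<and> close_maps X \<C>X (g \<circ> f) id)"

definition uniformly_bornologous_action ::
    "('g, 'r) monoid_scheme \<Rightarrow> 'a set set set \<Rightarrow> ('g \<Rightarrow> 'a \<Rightarrow> 'a) \<Rightarrow> bool" where
  "uniformly_bornologous_action G \<C> \<phi> \<longleftrightarrow>
     (\<forall>E. controlled \<C> E \<longrightarrow>
        (\<exists>E'. controlled \<C> E' \<and> (\<forall>(x, y) \<in> E. \<forall>g \<in> carrier G. (\<phi> g x, \<phi> g y) \<in> E')))"

definition coarsely_proper_action ::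
    "('g, 'r) monoid_scheme \<Rightarrow> 'a set \<Rightarrow> 'a set set set \<Rightarrow> ('g \<Rightarrow> 'a \<Rightarrow> 'a) \<Rightarrow> bool" where
  "coarsely_proper_action G X \<C> \<phi> \<longleftrightarrow>
     (\<forall>x \<in> X. \<forall>U \<subseteq> X. coarse_bounded \<C> U \<longrightarrow> finite {g \<in> carrier G. \<phi> g x \<in> U})"

definition cobounded_action ::
    "('g, 'r) monoid_scheme \<Rightarrow> 'a set \<Rightarrow> 'a set set set \<Rightarrow> ('g \<Rightarrow> 'a \<Rightarrow> 'a) \<Rightarrow> bool" where
  "cobounded_action G X \<C> \<phi> \<longleftrightarrow>
     (\<exists>U \<subseteq> X. coarse_bounded \<C> U \<and> X = (\<Union>g \<in> carrier G. \<phi> g ` U))"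

definition coarse_action ::
    "('g, 'r) monoid_scheme \<Rightarrow> 'a set \<Rightarrow> 'a set set set \<Rightarrow> ('g \<Rightarrow> 'a \<Rightarrow> 'a) \<Rightarrow> bool" where
  "coarse_action G X \<C> \<phi> \<longleftrightarrow>
     group_action G X \<phi> \<and>
     coarsely_proper_action G X \<C> \<phi> \<and>
     cobounded_action G X \<C> \<phi> \<and>
     uniformly_bornologous_action G \<C> \<phi>"

definition commuting_actions ::
    "('g, 'r) monoid_scheme \<Rightarrow> ('h, 's) monoid_scheme \<Rightarrow> 'a set \<Rightarrow>
     ('g \<Rightarrow> 'a \<Rightarrow> 'a) \<Rightarrow> ('h \<Rightarrow> 'a \<Rightarrow> 'a) \<Rightarrow> bool" where
  "commuting_actions G H X \<phi> \<psi> \<longleftrightarrow>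
     (\<forall>g \<in> carrier G. \<forall>h \<in> carrier H. \<forall>x \<in> X. \<phi> g (\<psi> h x) = \<psi> h (\<phi> g x))"

end

theory Submission
  imports Defs
begin

text \<open>
  Identify \<open>X\<close> with an orbit of either group.  When a group acts coboundedly by uniformly
  bornologous maps, the uniformly bounded families are exactly those whose members lie in
  translates \<open>g V\<close> of a single bounded set \<open>V\<close>
  (\<open>translates_uniformly_bounded\<close>, \<open>subset_translates\<close>).  So a coarse structure is
  determined by its bounded sets and the action, and the two structures of the theorem share their
  bounded sets.

  Moving one fundamental domain by the other group gives one bounded set \<open>U\<close> whose translates under
  \<open>G1\<close> and under \<open>G2\<close> both cover \<open>X\<close>; this works even if \<open>X\<close> has several coarse components.
  Fix a base point \<open>x0\<close>.  Were both actions simply transitive, the equivalence would be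
  \<open>g x0 \<mapsto> h x0\<close>, where \<open>g h x0 = x0\<close>.  In general this becomes a relation: \<open>x\<close> and \<open>y\<close> are partners
  if \<open>x \<in> g U\<close>, \<open>y \<in> h U\<close> and \<open>x0 \<in> g h U\<close> for some \<open>g\<close> and \<open>h\<close>.  Because the actions commute, the
  relation is symmetric under exchanging the two structures, so every estimate is needed in one
  direction only.  The estimate is \<open>partners_of_translate\<close>: all partners of points of \<open>g V\<close> lie
  in a single translate \<open>h W\<close>, where \<open>W\<close> is bounded and depends on \<open>V\<close> only.  Any functions chosen
  inside the relation, one in each direction, are then large scale uniform, coarsely proper, and
  inverse to each other up to closeness.
\<close>

section \<open>Uniformly bounded families\<close>

lemma uniformly_bounded_mono:
  assumes "coarse_structure X \<C>" "\<B> \<in> \<C>" "\<A> \<subseteq> Pow X"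
    and "\<And>A x y. A \<in> \<A> \<Longrightarrow> x \<in> A \<Longrightarrow> y \<in> A \<Longrightarrow> x \<noteq> y \<Longrightarrow> \<exists>B\<in>\<B>. A \<subseteq> B"
  shows "\<A> \<in> \<C>"
proof -
  have "\<forall>B\<in>\<A>. (\<exists>x\<in>B. \<exists>y\<in>B. x \<noteq> y) \<longrightarrow> (\<exists>A\<in>\<B>. B \<subseteq> A)"
    using assms(4) by blast
  with assms(1-3) show ?thesis unfolding coarse_structure_def by simp
qed

lemma uniformly_bounded_if_trivial:
  assumes "coarse_structure X \<C>" "\<A> \<subseteq> Pow X"
    and "\<And>A x y. A \<in> \<A> \<Longrightarrow> x \<in> A \<Longrightarrow> y \<in> A \<Longrightarrow> x = y"
  shows "\<A> \<in> \<C>"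
proof -
  have "\<C> \<noteq> {}"
    using assms(1) by (simp add: coarse_structure_def)
  then obtain \<B> where "\<B> \<in> \<C>" by blast
  from uniformly_bounded_mono[OF assms(1) this assms(2)] show ?thesis
    using assms(3) by metis
qed

lemma uniformly_bounded_subset_Pow:
  assumes "coarse_structure X \<C>" "\<B> \<in> \<C>"
  shows "\<B> \<subseteq> Pow X"
proof -
  have "\<C> \<subseteq> Pow (Pow X)" using assms(1) by (simp add: coarse_structure_def)
  with assms(2) show ?thesis by blast
qed

lemma star_family_uniformly_bounded:
  assumes "coarse_structure X \<C>" "\<A> \<in> \<C>" "\<B> \<in> \<C>"
  shows "star_family \<A> \<B> \<in> \<C>"
  using assms by (simp add: coarse_structure_def)

lemma coarse_bounded_subset_carrier:
  assumes "coarse_structure X \<C>" "coarse_bounded \<C> V"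
  shows "V \<subseteq> X"
  using uniformly_bounded_subset_Pow[OF assms(1)] assms(2) unfolding coarse_bounded_def by blast

lemma coarse_bounded_subset:
  assumes "coarse_structure X \<C>" "\<B> \<in> \<C>" "B \<in> \<B>" "A \<subseteq> B"
  shows "coarse_bounded \<C> A"
  unfolding coarse_bounded_def
proof (rule uniformly_bounded_mono[OF assms(1,2)])
  show "{A} \<subseteq> Pow X" using uniformly_bounded_subset_Pow[OF assms(1,2)] assms(3,4) by blast
qed (use assms(3,4) in blast)

lemma coarse_bounded_star:
  assumes "coarse_structure X \<C>" "coarse_bounded \<C> V" "\<B> \<in> \<C>"
  shows "coarse_bounded \<C> (star_set V \<B>)"
proof -
  have "star_family {V} \<B> = {star_set V \<B>}" by (auto simp: star_family_def)
  then show ?thesis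
    using star_family_uniformly_bounded[OF assms(1) _ assms(3), of "{V}"] assms(2)
    by (simp add: coarse_bounded_def)
qed

lemma subset_star_set: "V \<subseteq> star_set V \<B>"
  by (auto simp: star_set_def)

lemma member_subset_star_set: "A \<in> \<B> \<Longrightarrow> A \<inter> V \<noteq> {} \<Longrightarrow> A \<subseteq> star_set V \<B>"
  by (auto simp: star_set_def)

section \<open>Uniformly bornologous actions\<close>

locale bornologous_action = group_action G X \<phi>
  for G (structure) and X :: "'a set" and \<phi> +
  fixes \<C> :: "'a set set set"
  assumes coarse: "coarse_structure X \<C>"
    and bornologous: "uniformly_bornologous_action G \<C> \<phi>"
begin

abbreviation translates :: "'a set \<Rightarrow> 'a set set" where
  "translates A \<equiv> {\<phi> g ` A | g. g \<in> carrier G}"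

lemma group_G: "group G"
  using group_hom group_hom.axioms(1) by auto

lemma inv_closed: "g \<in> carrier G \<Longrightarrow> inv g \<in> carrier G"
  using group_G by (rule group.inv_closed)

lemma mult_closed: "g \<in> carrier G \<Longrightarrow> h \<in> carrier G \<Longrightarrow> g \<otimes> h \<in> carrier G"
  using group_G by (simp add: group.is_monoid monoid.m_closed)

lemma one_closed: "\<one> \<in> carrier G"
  using group_G by (simp add: group.is_monoid)

lemma action_closed: "g \<in> carrier G \<Longrightarrow> x \<in> X \<Longrightarrow> \<phi> g x \<in> X"
  using element_image by blast

lemma image_subset: "g \<in> carrier G \<Longrightarrow> A \<subseteq> X \<Longrightarrow> \<phi> g ` A \<subseteq> X"
  using action_closed by blast

lemma inv_cancel: "g \<in> carrier G \<Longrightarrow> x \<in> X \<Longrightarrow> \<phi> (inv g) (\<phi> g x) = x"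
  using orbit_sym_aux by blast

lemma inv_cancel': "g \<in> carrier G \<Longrightarrow> x \<in> X \<Longrightarrow> \<phi> g (\<phi> (inv g) x) = x"
  using inv_cancel[OF inv_closed] group_G by (simp add: group.inv_inv)

lemma subset_translate_if_inv:
  assumes "g \<in> carrier G" "B \<subseteq> X" "\<phi> (inv g) ` B \<subseteq> V"
  shows "B \<subseteq> \<phi> g ` V"
proof
  fix b assume "b \<in> B"
  then have "b = \<phi> g (\<phi> (inv g) b)" "\<phi> (inv g) b \<in> V"
    using inv_cancel'[OF assms(1)] assms(2,3) by auto
  then show "b \<in> \<phi> g ` V" by (rule image_eqI)
qed

lemma image_mult:
  assumes "g \<in> carrier G" "h \<in> carrier G" "A \<subseteq> X"
  shows "\<phi> (g \<otimes> h) ` A = \<phi> g ` \<phi> h ` A"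
  using assms composition_rule by (force simp: image_image)

text \<open>
  The hypothesis on the action speaks of pairs of points only: two points of \<open>g B\<close> share a member of
  a fixed family, but different pairs may need different members.  The star of a single point of
  \<open>g B\<close> contains all of these members at once.
\<close>

lemma family_translates_uniformly_bounded:
  assumes "\<B> \<in> \<C>"
  shows "{\<phi> g ` B | g B. g \<in> carrier G \<and> B \<in> \<B>} \<in> \<C>"
proof -
  have "controlled \<C> (\<Union>B\<in>\<B>. B \<times> B)"
    unfolding controlled_def using assms by blast
  then obtain E' where E': "controlled \<C> E'"
    "\<forall>(x, y)\<in>(\<Union>B\<in>\<B>. B \<times> B). \<forall>g\<in>carrier G. (\<phi> g x, \<phi> g y) \<in> E'"
    using bornologous unfolding uniformly_bornologous_action_def by meson
  then obtain \<D> where \<D>: "\<D> \<in> \<C>" "E' \<subseteq> (\<Union>D\<in>\<D>. D \<times> D)"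
    unfolding controlled_def by blast
  have "{{x} | x. x \<in> X} \<in> \<C>"
    by (rule uniformly_bounded_if_trivial[OF coarse]) auto
  then have star: "star_family {{x} | x. x \<in> X} \<D> \<in> \<C>"
    using star_family_uniformly_bounded[OF coarse] \<D>(1) by blast
  have sub: "{\<phi> g ` B | g B. g \<in> carrier G \<and> B \<in> \<B>} \<subseteq> Pow X"
    using image_subset uniformly_bounded_subset_Pow[OF coarse assms] by blast
  show ?thesis
  proof (rule uniformly_bounded_mono[OF coarse star sub])
    fix A p q
    assume A: "A \<in> {\<phi> g ` B | g B. g \<in> carrier G \<and> B \<in> \<B>}" and p: "p \<in> A"
    then have "p \<in> X" using sub by blast
    have "A \<subseteq> star_set {p} \<D>"
    proof
      fix z assume "z \<in> A"
      then have "(p, z) \<in> E'" using A p E'(2) by fast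
      then show "z \<in> star_set {p} \<D>" using \<D>(2) by (auto simp: star_set_def)
    qed
    then show "\<exists>S\<in>star_family {{x} | x. x \<in> X} \<D>. A \<subseteq> S"
      using \<open>p \<in> X\<close> by (auto simp: star_family_def)
  qed
qed

lemma translates_uniformly_bounded:
  assumes "coarse_bounded \<C> V"
  shows "translates V \<in> \<C>"
proof -
  have "{\<phi> g ` B | g B. g \<in> carrier G \<and> B \<in> {V}} = translates V" by blast
  then show ?thesis
    using family_translates_uniformly_bounded[of "{V}"] assms by (simp add: coarse_bounded_def)
qed

lemma coarse_bounded_translate:
  assumes "coarse_bounded \<C> V" "g \<in> carrier G"
  shows "coarse_bounded \<C> (\<phi> g ` V)"
  using coarse_bounded_subset[OF coarse translates_uniformly_bounded[OF assms(1)]] assms(2)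
  by blast

lemma coarse_bounded_star_translates:
  assumes "coarse_bounded \<C> A" "coarse_bounded \<C> B"
  shows "coarse_bounded \<C> (star_set A (translates B))"
  using coarse_bounded_star[OF coarse assms(1) translates_uniformly_bounded[OF assms(2)]] .

text \<open>
  Converse of \<open>translates_uniformly_bounded\<close>: since the translates of \<open>U\<close> cover \<open>X\<close>, every
  nonempty member of \<open>\<B>\<close> can be moved so that it meets \<open>U\<close>, and all the moved members together form
  one uniformly bounded family.  The set \<open>V\<close> is the star of \<open>U\<close> in this family.
\<close>

lemma subset_translates:
  assumes "\<B> \<in> \<C>" "coarse_bounded \<C> U" "X = (\<Union>g\<in>carrier G. \<phi> g ` U)"
  obtains V where "U \<subseteq> V" "coarse_bounded \<C> V"
    "\<forall>B\<in>\<B>. \<exists>g\<in>carrier G. B \<subseteq> \<phi> g ` V"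
proof
  let ?T = "{\<phi> g ` B | g B. g \<in> carrier G \<and> B \<in> \<B>}"
  show "U \<subseteq> star_set U ?T" by (rule subset_star_set)
  show "coarse_bounded \<C> (star_set U ?T)"
    using coarse_bounded_star[OF coarse assms(2) family_translates_uniformly_bounded[OF assms(1)]] .
  show "\<forall>B\<in>\<B>. \<exists>g\<in>carrier G. B \<subseteq> \<phi> g ` star_set U ?T"
  proof
    fix B assume B: "B \<in> \<B>"
    then have "B \<subseteq> X" using uniformly_bounded_subset_Pow[OF coarse assms(1)] by blast
    show "\<exists>g\<in>carrier G. B \<subseteq> \<phi> g ` star_set U ?T"
    proof (cases "B = {}")
      case True
      then show ?thesis using one_closed by blast
    next
      case False
      then obtain b where b: "b \<in> B" by blast
      then obtain g u where gu: "g \<in> carrier G" "u \<in> U" "b = \<phi> g u"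
        using \<open>B \<subseteq> X\<close> assms(3) by blast
      have "u \<in> X" using gu(2) coarse_bounded_subset_carrier[OF coarse assms(2)] by blast
      then have "u \<in> \<phi> (inv g) ` B" using inv_cancel gu b by (metis imageI)
      then have "\<phi> (inv g) ` B \<subseteq> star_set U ?T"
        using member_subset_star_set[of "\<phi> (inv g) ` B" ?T U] B inv_closed[OF gu(1)] gu(2) by blast
      then show ?thesis using subset_translate_if_inv gu(1) \<open>B \<subseteq> X\<close> by blast
    qed
  qed
qed

text \<open>
  The enlargement of \<open>A\<close> depends neither on \<open>g\<close> nor on \<open>k\<close>: by translation invariance the
  situation can be moved back to \<open>g = \<one>\<close>.
\<close>

lemma meeting_translate_subset:
  assumes "A \<subseteq> X" "B \<subseteq> X" "g \<in> carrier G" "k \<in> carrier G"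
    and "\<phi> g ` A \<inter> \<phi> k ` B \<noteq> {}"
  shows "\<phi> k ` B \<subseteq> \<phi> g ` star_set A (translates B)"
proof -
  have eq: "\<phi> (inv g \<otimes> k) ` B = \<phi> (inv g) ` \<phi> k ` B"
    using image_mult[OF inv_closed[OF assms(3)] assms(4,2)] .
  obtain a where a: "a \<in> A" "\<phi> g a \<in> \<phi> k ` B"
    using assms(5) by blast
  then have "a \<in> \<phi> (inv g \<otimes> k) ` B"
    unfolding eq using inv_cancel[OF assms(3)] assms(1) by (metis imageI subset_iff)
  then have "\<phi> (inv g \<otimes> k) ` B \<subseteq> star_set A (translates B)"
    using member_subset_star_set[of "\<phi> (inv g \<otimes> k) ` B" "translates B" A] a(1)
      mult_closed[OF inv_closed] assms(3,4) by blast
  then show ?thesis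
    using subset_translate_if_inv[OF assms(3) image_subset[OF assms(4,2)]] eq by simp
qed

end

section \<open>Commuting actions with a common fundamental domain\<close>

locale commuting_bornologous_actions =
  fst: bornologous_action G1 X \<phi>1 \<C>1 + snd: bornologous_action G2 X \<phi>2 \<C>2
  for G1 :: "('g, 'r) monoid_scheme" and G2 :: "('h, 's) monoid_scheme"
    and X :: "'a set" and \<phi>1 \<phi>2 \<C>1 \<C>2 +
  fixes U :: "'a set" and x0 :: 'a
  assumes bounded_iff: "B \<subseteq> X \<Longrightarrow> coarse_bounded \<C>1 B \<longleftrightarrow> coarse_bounded \<C>2 B"
    and commuting: "commuting_actions G1 G2 X \<phi>1 \<phi>2"
    and U_bounded: "coarse_bounded \<C>1 U"
    and fst_cover: "X = (\<Union>g\<in>carrier G1. \<phi>1 g ` U)"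
    and snd_cover: "X = (\<Union>h\<in>carrier G2. \<phi>2 h ` U)"
    and base_point: "x0 \<in> X"
begin

definition partner :: "'a \<Rightarrow> 'a \<Rightarrow> bool" where
  "partner x y \<longleftrightarrow> (\<exists>g\<in>carrier G1. \<exists>h\<in>carrier G2.
     x \<in> \<phi>1 g ` U \<and> y \<in> \<phi>2 h ` U \<and> x0 \<in> \<phi>1 g ` \<phi>2 h ` U)"

lemma U_subset: "U \<subseteq> X"
  using coarse_bounded_subset_carrier[OF fst.coarse U_bounded] .

lemma bounded_transfer: "coarse_bounded \<C>1 B \<Longrightarrow> coarse_bounded \<C>2 B"
  using bounded_iff coarse_bounded_subset_carrier[OF fst.coarse] by blast

lemma images_commute:
  assumes "g \<in> carrier G1" "h \<in> carrier G2" "A \<subseteq> X"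
  shows "\<phi>1 g ` \<phi>2 h ` A = \<phi>2 h ` \<phi>1 g ` A"
  using assms commuting unfolding commuting_actions_def by (force simp: image_image)

lemma exchanged: "commuting_bornologous_actions G2 G1 X \<phi>2 \<phi>1 \<C>2 \<C>1 U x0"
proof unfold_locales
  show "commuting_actions G2 G1 X \<phi>2 \<phi>1"
    using commuting unfolding commuting_actions_def by metis
qed (use bounded_iff bounded_transfer U_bounded fst_cover snd_cover base_point in auto)

lemma partner_exchanged:
  "commuting_bornologous_actions.partner G2 G1 \<phi>2 \<phi>1 U x0 y x \<longleftrightarrow> partner x y"
  unfolding partner_def commuting_bornologous_actions.partner_def[OF exchanged]
  using images_commute[OF _ _ U_subset] by metis

lemma partner_in_carrier: "partner x y \<Longrightarrow> x \<in> X \<and> y \<in> X"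
  unfolding partner_def using fst_cover snd_cover by blast

lemma obtain_partner_translate:
  assumes "g \<in> carrier G1"
  obtains h where "h \<in> carrier G2" "x0 \<in> \<phi>1 g ` \<phi>2 h ` U"
proof -
  have "\<phi>1 (inv\<^bsub>G1\<^esub> g) x0 \<in> X"
    using fst.action_closed fst.inv_closed assms base_point by blast
  then obtain h where "h \<in> carrier G2" "\<phi>1 (inv\<^bsub>G1\<^esub> g) x0 \<in> \<phi>2 h ` U"
    using snd_cover by blast
  then show ?thesis using that fst.inv_cancel'[OF assms base_point] by (metis imageI)
qed

lemma partner_exists:
  assumes "x \<in> X"
  shows "\<exists>y. partner x y"
proof -
  obtain g where g: "g \<in> carrier G1" "x \<in> \<phi>1 g ` U"
    using assms fst_cover by blast
  then obtain h where h: "h \<in> carrier G2" "x0 \<in> \<phi>1 g ` \<phi>2 h ` U"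
    using obtain_partner_translate by blast
  then obtain u where "u \<in> U" by blast
  then show ?thesis unfolding partner_def using g h by blast
qed

text \<open>
  Let \<open>y\<close> be a partner of a point of \<open>g V\<close>, through translates \<open>k U\<close> and \<open>l U\<close>.  Then \<open>k U\<close> meets
  \<open>g V\<close>, so it is contained in \<open>g V'\<close> with \<open>V'\<close> the star of \<open>V\<close> in the translates of \<open>U\<close>.
  Hence \<open>x0 \<in> l k U \<subseteq> l g V' = g l V'\<close>, that is, \<open>g\<^sup>-\<^sup>1 x0 \<in> l V'\<close>; it is here that commutation
  is used.  Now \<open>V'\<close> is also bounded in the second structure, and \<open>g\<^sup>-\<^sup>1 x0\<close> lies in a translate
  \<open>h U\<close> whose \<open>h\<close> depends on \<open>g\<close> only.  So \<open>l V'\<close> meets \<open>h U\<close> and is contained in \<open>h W\<close>, and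
  \<open>y \<in> l U \<subseteq> l V'\<close> because \<open>U \<subseteq> V\<close>.
\<close>

lemma partners_of_translate:
  assumes V: "coarse_bounded \<C>1 V" "U \<subseteq> V"
  obtains W where "coarse_bounded \<C>2 W"
    "\<forall>g\<in>carrier G1.
       \<exists>h\<in>carrier G2. \<forall>x y. x \<in> \<phi>1 g ` V \<longrightarrow> partner x y \<longrightarrow> y \<in> \<phi>2 h ` W"
proof
  let ?V' = "star_set V (fst.translates U)"
  let ?W = "star_set U (snd.translates ?V')"
  have V'1: "coarse_bounded \<C>1 ?V'"
    using fst.coarse_bounded_star_translates V(1) U_bounded by blast
  then have V'X: "?V' \<subseteq> X" using coarse_bounded_subset_carrier[OF fst.coarse] by blast
  have VX: "V \<subseteq> X" using coarse_bounded_subset_carrier[OF fst.coarse V(1)] .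
  have UV': "U \<subseteq> ?V'" using order_trans[OF V(2) subset_star_set] .
  show "coarse_bounded \<C>2 ?W"
    using snd.coarse_bounded_star_translates bounded_transfer U_bounded V'1 by blast
  show "\<forall>g\<in>carrier G1.
      \<exists>h\<in>carrier G2. \<forall>x y. x \<in> \<phi>1 g ` V \<longrightarrow> partner x y \<longrightarrow> y \<in> \<phi>2 h ` ?W"
  proof
    fix g assume g: "g \<in> carrier G1"
    obtain h where h: "h \<in> carrier G2" "x0 \<in> \<phi>1 g ` \<phi>2 h ` U"
      using obtain_partner_translate[OF g] .
    have "y \<in> \<phi>2 h ` ?W" if x: "x \<in> \<phi>1 g ` V" and "partner x y" for x y
    proof -
      obtain k l where kl: "k \<in> carrier G1" "l \<in> carrier G2"
        "x \<in> \<phi>1 k ` U" "y \<in> \<phi>2 l ` U" "x0 \<in> \<phi>1 k ` \<phi>2 l ` U"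
        using \<open>partner x y\<close> unfolding partner_def by blast
      have "\<phi>1 k ` U \<subseteq> \<phi>1 g ` ?V'"
        using fst.meeting_translate_subset[OF VX U_subset g kl(1)] x kl(3) by blast
      then have "\<phi>1 k ` \<phi>2 l ` U \<subseteq> \<phi>1 g ` \<phi>2 l ` ?V'"
        unfolding images_commute[OF kl(1,2) U_subset] images_commute[OF g kl(2) V'X]
        by (rule image_mono)
      then have x0: "x0 \<in> \<phi>1 g ` \<phi>2 l ` ?V'"
        using kl(5) by (rule subsetD)
      have sub: "\<phi>2 h ` U \<subseteq> X" "\<phi>2 l ` ?V' \<subseteq> X"
        using snd.image_subset h(1) kl(2) U_subset V'X by blast+
      have "x0 \<in> \<phi>1 g ` (\<phi>2 h ` U \<inter> \<phi>2 l ` ?V')"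
        using inj_on_image_Int[OF fst.inj_prop[OF g] sub] h(2) x0 by blast
      then have "\<phi>2 h ` U \<inter> \<phi>2 l ` ?V' \<noteq> {}" by blast
      then have "\<phi>2 l ` ?V' \<subseteq> \<phi>2 h ` ?W"
        using snd.meeting_translate_subset[OF U_subset V'X h(1) kl(2)] by blast
      then show ?thesis using kl(4) UV' by blast
    qed
    then show "\<exists>h\<in>carrier G2. \<forall>x y. x \<in> \<phi>1 g ` V \<longrightarrow> partner x y \<longrightarrow> y \<in> \<phi>2 h ` ?W"
      using h(1) by blast
  qed
qed

lemma partners_of_uniformly_bounded:
  assumes "\<B> \<in> \<C>1"
  obtains \<D> where "\<D> \<in> \<C>2"
    "\<forall>B\<in>\<B>. \<exists>D\<in>\<D>. \<forall>x y. x \<in> B \<longrightarrow> partner x y \<longrightarrow> y \<in> D"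
proof -
  obtain V where V: "U \<subseteq> V" "coarse_bounded \<C>1 V"
    "\<forall>B\<in>\<B>. \<exists>g\<in>carrier G1. B \<subseteq> \<phi>1 g ` V"
    using fst.subset_translates[OF assms U_bounded fst_cover] .
  obtain W where W: "coarse_bounded \<C>2 W"
    "\<forall>g\<in>carrier G1.
       \<exists>h\<in>carrier G2. \<forall>x y. x \<in> \<phi>1 g ` V \<longrightarrow> partner x y \<longrightarrow> y \<in> \<phi>2 h ` W"
    using partners_of_translate[OF V(2,1)] by blast
  show ?thesis
  proof
    show "snd.translates W \<in> \<C>2" using snd.translates_uniformly_bounded[OF W(1)] .
    show "\<forall>B\<in>\<B>. \<exists>D\<in>snd.translates W. \<forall>x y. x \<in> B \<longrightarrow> partner x y \<longrightarrow> y \<in> D"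
    proof
      fix B assume "B \<in> \<B>"
      then obtain g where g: "g \<in> carrier G1" "B \<subseteq> \<phi>1 g ` V" using V(3) by blast
      then obtain h where h: "h \<in> carrier G2"
        "\<forall>x y. x \<in> \<phi>1 g ` V \<longrightarrow> partner x y \<longrightarrow> y \<in> \<phi>2 h ` W"
        using W(2) by blast
      have "\<phi>2 h ` W \<in> snd.translates W" using h(1) by blast
      moreover have "\<forall>x y. x \<in> B \<longrightarrow> partner x y \<longrightarrow> y \<in> \<phi>2 h ` W"
        using h(2) subsetD[OF g(2)] by metis
      ultimately show "\<exists>D\<in>snd.translates W. \<forall>x y. x \<in> B \<longrightarrow> partner x y \<longrightarrow> y \<in> D"
        by (rule bexI[rotated])
    qed
  qed
qed

lemma converse_partners_of_uniformly_bounded: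
  assumes "\<B> \<in> \<C>2"
  obtains \<D> where "\<D> \<in> \<C>1"
    "\<forall>B\<in>\<B>. \<exists>D\<in>\<D>. \<forall>x y. y \<in> B \<longrightarrow> partner x y \<longrightarrow> x \<in> D"
  using commuting_bornologous_actions.partners_of_uniformly_bounded[OF exchanged assms]
  unfolding partner_exchanged by metis

text \<open>
  Large scale uniformity is the estimate on partners; coarse properness is the same estimate for
  the exchanged relation, because the points mapped into \<open>V\<close> are partners of points of \<open>V\<close>.
\<close>

lemma coarse_map_of_partners:
  assumes f: "\<And>x. x \<in> X \<Longrightarrow> partner x (f x)"
  shows "coarse_map X \<C>1 X \<C>2 f"
  unfolding coarse_map_def
proof (intro conjI)
  show fX: "f \<in> X \<rightarrow> X" using f partner_in_carrier by blast
  show "large_scale_uniform \<C>1 \<C>2 f"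
    unfolding large_scale_uniform_def
  proof
    fix \<B> assume \<B>: "\<B> \<in> \<C>1"
    then have BX: "\<B> \<subseteq> Pow X" by (rule uniformly_bounded_subset_Pow[OF fst.coarse])
    obtain \<D> where \<D>: "\<D> \<in> \<C>2"
      "\<forall>B\<in>\<B>. \<exists>D\<in>\<D>. \<forall>x y. x \<in> B \<longrightarrow> partner x y \<longrightarrow> y \<in> D"
      using partners_of_uniformly_bounded[OF \<B>] .
    show "{f ` B | B. B \<in> \<B>} \<in> \<C>2"
    proof (rule uniformly_bounded_mono[OF snd.coarse \<D>(1)])
      show "{f ` B | B. B \<in> \<B>} \<subseteq> Pow X" using BX fX by blast
      fix A p q assume "A \<in> {f ` B | B. B \<in> \<B>}"
      then obtain B where B: "B \<in> \<B>" "A = f ` B" by blast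
      then obtain D where "D \<in> \<D>" "\<forall>x y. x \<in> B \<longrightarrow> partner x y \<longrightarrow> y \<in> D"
        using \<D>(2) by blast
      then show "\<exists>D\<in>\<D>. A \<subseteq> D" using B BX f by blast
    qed
  qed
  show "coarsely_proper_map X \<C>1 X \<C>2 f"
    unfolding coarsely_proper_map_def
  proof (intro allI impI)
    fix V assume "coarse_bounded \<C>2 V"
    then obtain \<D> where \<D>: "\<D> \<in> \<C>1"
      "\<forall>B\<in>{V}. \<exists>D\<in>\<D>. \<forall>x y. y \<in> B \<longrightarrow> partner x y \<longrightarrow> x \<in> D"
      using converse_partners_of_uniformly_bounded unfolding coarse_bounded_def by blast
    then obtain D where D: "D \<in> \<D>" "\<forall>x y. y \<in> V \<longrightarrow> partner x y \<longrightarrow> x \<in> D"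
      by blast
    have "f -` V \<inter> X \<subseteq> D" using D(2) f by blast
    then show "coarse_bounded \<C>1 (f -` V \<inter> X)"
      by (rule coarse_bounded_subset[OF fst.coarse \<D>(1) D(1)])
  qed
qed

text \<open>Both \<open>y\<close> and \<open>f (f' y)\<close> are partners of the single point \<open>f' y\<close>.\<close>

lemma close_id_of_partners:
  assumes f: "\<And>x. x \<in> X \<Longrightarrow> partner x (f x)"
    and f': "\<And>y. y \<in> X \<Longrightarrow> partner (f' y) y"
  shows "close_maps X \<C>2 (f \<circ> f') id"
proof -
  have "{{x} | x. x \<in> X} \<in> \<C>1"
    by (rule uniformly_bounded_if_trivial[OF fst.coarse]) auto
  then obtain \<D> where \<D>: "\<D> \<in> \<C>2"
    "\<forall>B\<in>{{x} | x. x \<in> X}. \<exists>D\<in>\<D>. \<forall>x y. x \<in> B \<longrightarrow> partner x y \<longrightarrow> y \<in> D"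
    using partners_of_uniformly_bounded by blast
  have ff': "partner (f' y) (f (f' y))" if "y \<in> X" for y
    using f f' partner_in_carrier that by blast
  show ?thesis
    unfolding close_maps_def
  proof (rule uniformly_bounded_mono[OF snd.coarse \<D>(1)])
    show "{{(f \<circ> f') s, id s} | s. s \<in> X} \<subseteq> Pow X"
      using ff' partner_in_carrier by auto
    fix A p q assume "A \<in> {{(f \<circ> f') s, id s} | s. s \<in> X}"
    then obtain y where y: "y \<in> X" "A = {f (f' y), y}" by auto
    then have "{f' y} \<in> {{x} | x. x \<in> X}"
      using partner_in_carrier[OF f'[OF y(1)]] by blast
    from bspec[OF \<D>(2) this]
    obtain D where D: "D \<in> \<D>" "\<forall>x z. x \<in> {f' y} \<longrightarrow> partner x z \<longrightarrow> z \<in> D"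
      by (rule bexE)
    have "A \<subseteq> D" using D(2) y(2) f'[OF y(1)] ff'[OF y(1)] by simp
    then show "\<exists>D\<in>\<D>. A \<subseteq> D" using D(1) by (rule bexI)
  qed
qed

theorem coarse_equivalence_exists: "\<exists>f. coarse_equivalence X \<C>1 X \<C>2 f"
proof -
  obtain f where f: "\<And>x. x \<in> X \<Longrightarrow> partner x (f x)"
    using partner_exists by metis
  have "\<exists>x. partner x y" if "y \<in> X" for y
    using commuting_bornologous_actions.partner_exists[OF exchanged that]
    unfolding partner_exchanged .
  then obtain f' where f': "\<And>y. y \<in> X \<Longrightarrow> partner (f' y) y"
    by metis
  have "coarse_map X \<C>2 X \<C>1 f'"
    using commuting_bornologous_actions.coarse_map_of_partners[OF exchanged]
    unfolding partner_exchanged using f' by blast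
  moreover have "close_maps X \<C>1 (f' \<circ> f) id"
    using commuting_bornologous_actions.close_id_of_partners[OF exchanged]
    unfolding partner_exchanged using f f' by blast
  ultimately show ?thesis
    unfolding coarse_equivalence_def
    using coarse_map_of_partners[OF f] close_id_of_partners[OF f f'] by blast
qed

end

section \<open>A common fundamental domain\<close>

text \<open>
  The empty set has no base point, but it carries only one coarse structure: all of its families
  of subsets are uniformly bounded.
\<close>

lemma coarse_equivalence_empty:
  assumes "coarse_structure {} \<C>1" "coarse_structure {} \<C>2"
  shows "coarse_equivalence {} \<C>1 {} \<C>2 id"
proof -
  have eq: "\<C> = Pow (Pow {})" if "coarse_structure {} \<C>" for \<C> :: "'a set set set"
  proof
    show "\<C> \<subseteq> Pow (Pow {})" using uniformly_bounded_subset_Pow[OF that] by blast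
    show "Pow (Pow {}) \<subseteq> \<C>"
    proof
      fix \<A> :: "'a set set" assume "\<A> \<in> Pow (Pow {})"
      then have "\<A> \<subseteq> Pow {}" by blast
      then show "\<A> \<in> \<C>"
        by (rule uniformly_bounded_if_trivial[OF that]) (use \<open>\<A> \<subseteq> Pow {}\<close> in blast)
    qed
  qed
  have "coarse_map {} (Pow (Pow {})) {} (Pow (Pow {})) (id :: 'a \<Rightarrow> 'a)"
    unfolding coarse_map_def large_scale_uniform_def coarsely_proper_map_def coarse_bounded_def
    by auto
  then show ?thesis
    unfolding coarse_equivalence_def close_maps_def eq[OF assms(1)] eq[OF assms(2)]
    by (intro conjI exI[where x = id]) simp_all
qed

text \<open>
  The union of two bounded sets may be unbounded, so the two fundamental domains cannot simply be
  united.  Instead an element \<open>k\<close> of the second group moves the first one until it meets the second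
  one, after which the union is bounded.  As the actions commute, the \<open>G1\<close>-translates of \<open>k U1\<close> still
  cover: their union is \<open>k (G1 U1) = k X = X\<close>.
\<close>

lemma common_fundamental_domain:
  assumes "bornologous_action G2 X \<phi>2 \<C>2" "group_action G1 X \<phi>1"
    and comm: "commuting_actions G1 G2 X \<phi>1 \<phi>2"
    and "X \<noteq> {}"
    and U1: "coarse_bounded \<C>2 U1" "X = (\<Union>g\<in>carrier G1. \<phi>1 g ` U1)"
    and U2: "coarse_bounded \<C>2 U2" "X = (\<Union>h\<in>carrier G2. \<phi>2 h ` U2)"
  obtains U where "coarse_bounded \<C>2 U"
    "X = (\<Union>g\<in>carrier G1. \<phi>1 g ` U)" "X = (\<Union>h\<in>carrier G2. \<phi>2 h ` U)"
proof -
  interpret A2: bornologous_action G2 X \<phi>2 \<C>2 by fact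
  interpret A1: group_action G1 X \<phi>1 by fact
  have sub: "U1 \<subseteq> X" "U2 \<subseteq> X"
    using coarse_bounded_subset_carrier[OF A2.coarse] U1(1) U2(1) by blast+
  obtain u1 where u1: "u1 \<in> U1" using \<open>X \<noteq> {}\<close> U1(2) by blast
  then obtain h u2 where h: "h \<in> carrier G2" "u2 \<in> U2" "u1 = \<phi>2 h u2"
    using U2(2) sub(1) by blast
  define k where "k = inv\<^bsub>G2\<^esub> h"
  have k: "k \<in> carrier G2" unfolding k_def using A2.inv_closed h(1) .
  have "u2 \<in> \<phi>2 k ` U1"
    unfolding k_def using A2.inv_cancel[OF h(1)] h(2,3) sub(2) u1 by (metis imageI subset_iff)
  define U where "U = U2 \<union> \<phi>2 k ` U1"
  have "U = star_set U2 {\<phi>2 k ` U1}"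
    using \<open>u2 \<in> \<phi>2 k ` U1\<close> h(2) by (auto simp: U_def star_set_def)
  moreover have "{\<phi>2 k ` U1} \<in> \<C>2"
    using A2.coarse_bounded_translate[OF U1(1) k] by (simp add: coarse_bounded_def)
  ultimately have bounded: "coarse_bounded \<C>2 U"
    using coarse_bounded_star[OF A2.coarse U2(1)] by simp
  then have UX: "U \<subseteq> X" by (rule coarse_bounded_subset_carrier[OF A2.coarse])
  have "X = \<phi>2 k ` X" using A2.surj_prop[OF k] by simp
  also have "\<dots> = \<phi>2 k ` (\<Union>g\<in>carrier G1. \<phi>1 g ` U1)"
    using U1(2) by simp
  also have "\<dots> = (\<Union>g\<in>carrier G1. \<phi>2 k ` \<phi>1 g ` U1)"
    by (rule image_UN)
  also have "\<dots> = (\<Union>g\<in>carrier G1. \<phi>1 g ` \<phi>2 k ` U1)"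
  proof (rule SUP_cong)
    fix g assume "g \<in> carrier G1"
    then show "\<phi>2 k ` \<phi>1 g ` U1 = \<phi>1 g ` \<phi>2 k ` U1"
      using comm k sub(1) unfolding commuting_actions_def by (force simp: image_image)
  qed simp
  also have "\<dots> \<subseteq> (\<Union>g\<in>carrier G1. \<phi>1 g ` U)" unfolding U_def by blast
  finally have "X \<subseteq> (\<Union>g\<in>carrier G1. \<phi>1 g ` U)" .
  moreover have "(\<Union>g\<in>carrier G1. \<phi>1 g ` U) \<subseteq> X"
    using A1.surj_prop UX by blast
  ultimately have cover1: "X = (\<Union>g\<in>carrier G1. \<phi>1 g ` U)"
    by (rule subset_antisym)
  have "X \<subseteq> (\<Union>h\<in>carrier G2. \<phi>2 h ` U)"
    using U2(2) unfolding U_def by blast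
  moreover have "(\<Union>h\<in>carrier G2. \<phi>2 h ` U) \<subseteq> X"
    using A2.image_subset UX by blast
  ultimately have cover2: "X = (\<Union>h\<in>carrier G2. \<phi>2 h ` U)"
    by (rule subset_antisym)
  from bounded cover1 cover2 show ?thesis by (rule that)
qed

theorem theorem0p2:
  fixes X :: "'a set" and \<C>1 \<C>2 :: "'a set set set"
    and G1 :: "('g, 'r) monoid_scheme" and G2 :: "('h, 's) monoid_scheme"
    and \<phi>1 :: "'g \<Rightarrow> 'a \<Rightarrow> 'a" and \<phi>2 :: "'h \<Rightarrow> 'a \<Rightarrow> 'a"
  assumes "coarse_structure X \<C>1" and "coarse_structure X \<C>2"
    and "\<forall>B \<subseteq> X. coarse_bounded \<C>1 B \<longleftrightarrow> coarse_bounded \<C>2 B"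
    and "coarse_action G1 X \<C>1 \<phi>1" and "coarse_action G2 X \<C>2 \<phi>2"
    and "commuting_actions G1 G2 X \<phi>1 \<phi>2"
  shows "\<exists>f. coarse_equivalence X \<C>1 X \<C>2 f"
proof (cases "X = {}")
  case True
  then show ?thesis using coarse_equivalence_empty assms(1,2) by blast
next
  case False
  have act1: "bornologous_action G1 X \<phi>1 \<C>1" and act2: "bornologous_action G2 X \<phi>2 \<C>2"
    using assms(1,2,4,5)
    by (simp_all add: coarse_action_def bornologous_action_def bornologous_action_axioms_def)
  obtain U1 where U1: "U1 \<subseteq> X" "coarse_bounded \<C>1 U1" "X = (\<Union>g\<in>carrier G1. \<phi>1 g ` U1)"
    using assms(4) unfolding coarse_action_def cobounded_action_def by blast
  obtain U2 where U2: "coarse_bounded \<C>2 U2" "X = (\<Union>h\<in>carrier G2. \<phi>2 h ` U2)"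
    using assms(5) unfolding coarse_action_def cobounded_action_def by blast
  have "coarse_bounded \<C>2 U1" using assms(3) U1(1,2) by blast
  then obtain U where U: "coarse_bounded \<C>2 U"
    "X = (\<Union>g\<in>carrier G1. \<phi>1 g ` U)" "X = (\<Union>h\<in>carrier G2. \<phi>2 h ` U)"
    using common_fundamental_domain[OF act2 bornologous_action.axioms(1)[OF act1] assms(6) False]
      U1(3) U2 by metis
  have "coarse_bounded \<C>1 U"
    using assms(3) U(1) coarse_bounded_subset_carrier[OF assms(2)] by blast
  moreover obtain x0 where "x0 \<in> X" using False by blast
  ultimately have "commuting_bornologous_actions G1 G2 X \<phi>1 \<phi>2 \<C>1 \<C>2 U x0"
    using act1 act2 assms(3,6) U(2,3)
    unfolding commuting_bornologous_actions_def commuting_bornologous_actions_axioms_def by blast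
  then show ?thesis by (rule commuting_bornologous_actions.coarse_equivalence_exists)
qed

end
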